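(* Let $M$ be a submonoid of a monoid $A$. Then $M$ is the positive cone of some preorder on $A$ if and only if the following condition holds: (P) for every $x,y\in A$ and every $u\in M$, $\;xy\in M\Rightarrow xuy\in M$. In this case, $M$ is the positive cone of $\leq_M$.
   Context: Monoids are written multiplicatively with unit $1$. A preorder on the monoid $A$ means an internal preorder: a reflexive and transitive relation on $A$ that is compatible with the monoid operation, i.e. a submonoid of $A\times A$. The positive cone of a preorder $\leq$ is its zero-class $\{u\in A\mid 1\leq u\}$. The syntactic preorder $\leq_M$ on $A$ is defined by: $a\leq_M b$ if for every $x,y\in A$, $xay\in M\Rightarrow xby\in M$. *)

theory Defs
  imports "HOL-Algebra.Group"
begin

definition internal_preorder :: "('a, 'b) monoid_scheme \<Rightarrow> 'a rel \<Rightarrow> bool" where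
  "internal_preorder A R \<longleftrightarrow> preorder_on (carrier A) R \<and> submonoid R (A \<times>\<times> A)"

definition positive_cone :: "('a, 'b) monoid_scheme \<Rightarrow> 'a rel \<Rightarrow> 'a set" where
  "positive_cone A R = {u \<in> carrier A. (\<one>\<^bsub>A\<^esub>, u) \<in> R}"

definition syntactic_preorder :: "('a, 'b) monoid_scheme \<Rightarrow> 'a set \<Rightarrow> 'a rel" where
  "syntactic_preorder A M =
     {(a, b). a \<in> carrier A \<and> b \<in> carrier A \<and>
        (\<forall>x\<in>carrier A. \<forall>y\<in>carrier A.
           x \<otimes>\<^bsub>A\<^esub> a \<otimes>\<^bsub>A\<^esub> y \<in> M \<longrightarrow> x \<otimes>\<^bsub>A\<^esub> b \<otimes>\<^bsub>A\<^esub> y \<in> M)}"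

definition insertion_closed :: "('a, 'b) monoid_scheme \<Rightarrow> 'a set \<Rightarrow> bool" where
  "insertion_closed A M \<longleftrightarrow>
     (\<forall>x\<in>carrier A. \<forall>y\<in>carrier A. \<forall>u\<in>M.
        x \<otimes>\<^bsub>A\<^esub> y \<in> M \<longrightarrow> x \<otimes>\<^bsub>A\<^esub> u \<otimes>\<^bsub>A\<^esub> y \<in> M)"

lemma internal_preorder_syntactic_preorder:
  assumes "monoid A"
  shows "internal_preorder A (syntactic_preorder A M)"
proof -
  interpret monoid A by fact
  let ?R = "syntactic_preorder A M"
  have "preorder_on (carrier A) ?R"
    by (auto simp: preorder_on_def refl_on_def trans_def syntactic_preorder_def)
  moreover have "submonoid ?R (A \<times>\<times> A)"
  proof
    show "?R \<subseteq> carrier (A \<times>\<times> A)"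
      by (auto simp: syntactic_preorder_def)
    show "\<one>\<^bsub>A \<times>\<times> A\<^esub> \<in> ?R"
      by (simp add: syntactic_preorder_def)
  next
    fix p q assume "p \<in> ?R" "q \<in> ?R"
    then obtain a b c d where pq: "p = (a, b)" "q = (c, d)"
      and ab: "(a, b) \<in> ?R" and cd: "(c, d) \<in> ?R"
      by (metis surj_pair)
    have carr: "a \<in> carrier A" "b \<in> carrier A" "c \<in> carrier A" "d \<in> carrier A"
      using ab cd by (auto simp: syntactic_preorder_def)
    have "x \<otimes>\<^bsub>A\<^esub> (b \<otimes>\<^bsub>A\<^esub> d) \<otimes>\<^bsub>A\<^esub> y \<in> M"
      if xy: "x \<in> carrier A" "y \<in> carrier A"
        and M: "x \<otimes>\<^bsub>A\<^esub> (a \<otimes>\<^bsub>A\<^esub> c) \<otimes>\<^bsub>A\<^esub> y \<in> M" for x y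
    proof -
      have "x \<otimes>\<^bsub>A\<^esub> a \<otimes>\<^bsub>A\<^esub> (c \<otimes>\<^bsub>A\<^esub> y) \<in> M"
        using M xy carr by (simp add: m_assoc)
      then have "x \<otimes>\<^bsub>A\<^esub> b \<otimes>\<^bsub>A\<^esub> (c \<otimes>\<^bsub>A\<^esub> y) \<in> M"
        using ab xy carr by (simp add: syntactic_preorder_def)
      then have "(x \<otimes>\<^bsub>A\<^esub> b) \<otimes>\<^bsub>A\<^esub> c \<otimes>\<^bsub>A\<^esub> y \<in> M"
        using xy carr by (simp add: m_assoc)
      then have "(x \<otimes>\<^bsub>A\<^esub> b) \<otimes>\<^bsub>A\<^esub> d \<otimes>\<^bsub>A\<^esub> y \<in> M"
        using cd xy carr unfolding syntactic_preorder_def by blast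
      then show ?thesis
        using xy carr by (simp add: m_assoc)
    qed
    then show "p \<otimes>\<^bsub>A \<times>\<times> A\<^esub> q \<in> ?R"
      using carr by (simp add: pq syntactic_preorder_def)
  qed
  ultimately show ?thesis
    by (simp add: internal_preorder_def)
qed

end

theory Submission
  imports Defs
begin

text \<open>Multiplying 1 \<le> u by x on the left and y on the right gives xy \<le> xuy, so
  transitivity turns 1 \<le> xy into 1 \<le> xuy: every positive cone satisfies (P)
  (\<open>insertion_closed_positive_cone\<close>). Conversely, 1 \<le> u in the syntactic preorder
  of M means that inserting u into any product xy in M stays in M. Under (P) every u in M has this
  property, and the empty context x = y = 1 shows that no other u does
  (\<open>positive_cone_syntactic_preorder\<close>). As the syntactic preorder is always internal,
  it witnesses existence.\<close>

lemma internal_preorder_mult: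
  assumes "internal_preorder A R" "(a, b) \<in> R" "(c, d) \<in> R"
  shows "(a \<otimes>\<^bsub>A\<^esub> c, b \<otimes>\<^bsub>A\<^esub> d) \<in> R"
  using assms submonoid.m_closed[of R "A \<times>\<times> A" "(a, b)" "(c, d)"]
  by (simp add: internal_preorder_def)

lemma insertion_closed_positive_cone:
  assumes "monoid A" and R: "internal_preorder A R"
  shows "insertion_closed A (positive_cone A R)"
  unfolding insertion_closed_def
proof (intro ballI impI)
  interpret monoid A by fact
  fix x y u
  assume xy: "x \<in> carrier A" "y \<in> carrier A" and u: "u \<in> positive_cone A R"
    and pos: "x \<otimes>\<^bsub>A\<^esub> y \<in> positive_cone A R"
  have refl: "(z, z) \<in> R" if "z \<in> carrier A" for z
    using R that by (auto simp: internal_preorder_def preorder_on_def refl_on_def)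
  have trans: "trans R"
    using R by (auto simp: internal_preorder_def preorder_on_def)
  have u': "u \<in> carrier A" "(\<one>\<^bsub>A\<^esub>, u) \<in> R"
    using u by (auto simp: positive_cone_def)
  \<comment> \<open>Product in \<open>R\<close> of the three pairs (x, x), (1, u) and (y, y). The
    unit is kept on the left so that the factors match; it is simplified away before transitivity is
    applied.\<close>
  have "(x \<otimes>\<^bsub>A\<^esub> \<one>\<^bsub>A\<^esub> \<otimes>\<^bsub>A\<^esub> y, x \<otimes>\<^bsub>A\<^esub> u \<otimes>\<^bsub>A\<^esub> y) \<in> R"
    using xy u' by (intro internal_preorder_mult[OF R] refl)
  moreover have "(\<one>\<^bsub>A\<^esub>, x \<otimes>\<^bsub>A\<^esub> y) \<in> R"
    using pos by (simp add: positive_cone_def)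
  ultimately have "(\<one>\<^bsub>A\<^esub>, x \<otimes>\<^bsub>A\<^esub> u \<otimes>\<^bsub>A\<^esub> y) \<in> R"
    using xy trans by (auto dest: transD)
  then show "x \<otimes>\<^bsub>A\<^esub> u \<otimes>\<^bsub>A\<^esub> y \<in> positive_cone A R"
    using xy u' by (simp add: positive_cone_def)
qed

text \<open>Once the unit in x1y is cancelled, u lying above 1 is the instance of (P) for that u, so
  (P) gives the inclusion of \<open>M\<close> in the cone. The reverse inclusion rests on 1 being in
  \<open>M\<close>.\<close>

lemma positive_cone_syntactic_preorder:
  assumes "monoid A" and "submonoid M A" and closed: "insertion_closed A M"
  shows "positive_cone A (syntactic_preorder A M) = M"
proof -
  interpret monoid A by fact
  interpret M: submonoid M A by fact
  show ?thesis
  proof (intro equalityI subsetI)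
    fix u assume "u \<in> positive_cone A (syntactic_preorder A M)"
    then have "u \<in> carrier A" and imp: "\<And>x y. \<lbrakk>x \<in> carrier A; y \<in> carrier A; x \<otimes>\<^bsub>A\<^esub> \<one>\<^bsub>A\<^esub> \<otimes>\<^bsub>A\<^esub> y \<in> M\<rbrakk>
        \<Longrightarrow> x \<otimes>\<^bsub>A\<^esub> u \<otimes>\<^bsub>A\<^esub> y \<in> M"
      by (auto simp: positive_cone_def syntactic_preorder_def)
    \<comment> \<open>In the empty context the premise reduces to 1 being in \<open>M\<close>, and
      the conclusion to u being in \<open>M\<close>.\<close>
    then show "u \<in> M"
      using imp[of "\<one>\<^bsub>A\<^esub>" "\<one>\<^bsub>A\<^esub>"] by simp
  next
    fix u assume "u \<in> M"
    then show "u \<in> positive_cone A (syntactic_preorder A M)"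
      using closed M.mem_carrier
      by (auto simp: positive_cone_def syntactic_preorder_def insertion_closed_def)
  qed
qed

theorem proposition2:
  fixes A :: "('a, 'b) monoid_scheme" and M :: "'a set"
  assumes "monoid A" and "submonoid M A"
  shows "((\<exists>R. internal_preorder A R \<and> M = positive_cone A R) \<longleftrightarrow> insertion_closed A M) \<and>
         (insertion_closed A M \<longrightarrow> M = positive_cone A (syntactic_preorder A M))"
  \<comment> \<open>From (P), the existential is witnessed by
    \<open>syntactic_preorder A M\<close>.\<close>
  using assms insertion_closed_positive_cone positive_cone_syntactic_preorder
    internal_preorder_syntactic_preorder by metis

end
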